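(* Let $\mathcal{M}=(S,\rightarrow,\ell)$ be a WTS and $s,t\in S$. If $s\sim t$, then for every $\varphi\in\mathcal{L}$: $\mathcal{M},s\models\varphi$ iff $\mathcal{M},t\models\varphi$. Furthermore, if $\mathcal{M}$ is image-finite, then conversely, if for every $\varphi\in\mathcal{L}$ we have $\mathcal{M},s\models\varphi$ iff $\mathcal{M},t\models\varphi$, then $s\sim t$.
   Context: Fix a countable set $\mathcal{AP}$ of atomic propositions. A weighted transition system (WTS) is a triple $\mathcal{M}=(S,\rightarrow,\ell)$ where $S$ is a non-empty set of states, $\rightarrow\subseteq S\times\mathbb{R}_{\ge 0}\times S$ is a transition relation (write $s\xrightarrow{r}t$), and $\ell:S\to 2^{\mathcal{AP}}$ is a labeling. $\mathcal{M}$ is image-finite if for every $s\in S$ there are only finitely many $t\in S$ with $s\xrightarrow{r}t$ for some $r$. For $s\in S$, $T\subseteq S$ let $\theta(s)(T)=\{r\mid \exists t\in T,\ s\xrightarrow{r}t\}$; $\theta^-(s)(T)=-\infty$ if $\theta(s)(T)=\emptyset$, else $\inf\theta(s)(T)$; $\theta^+(s)(T)=\infty$ if $\theta(s)(T)=\emptyset$, else $\sup\theta(s)(T)$. A generalized weighted bisimulation relation on $\mathcal{M}$ is an equivalence relation $\mathcal{R}$ on $S$ such that whenever $s\mathcal{R}t$: $\ell(s)=\ell(t)$, and for every $\mathcal{R}$-equivalence class $T$, $\theta^-(s)(T)=\theta^-(t)(T)$ and $\theta^+(s)(T)=\theta^+(t)(T)$. $s\sim t$ iff there exists a generalized weighted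 bisimulation relation $\mathcal{R}$ with $s\mathcal{R}t$. Formulae of $\mathcal{L}$: $\varphi::= p\mid\neg\varphi\mid\varphi\wedge\varphi\mid L_r\varphi\mid M_r\varphi$ with $p\in\mathcal{AP}$, $r\in\mathbb{Q}_{\ge0}$. Semantics: $\mathcal{M},s\models p$ iff $p\in\ell(s)$; Boolean cases as usual; $\mathcal{M},s\models L_r\varphi$ iff $\theta^-(s)([\![\varphi]\!])\ge r$; $\mathcal{M},s\models M_r\varphi$ iff $\theta^+(s)([\![\varphi]\!])\le r$, where $[\![\varphi]\!]=\{s\in S\mid\mathcal{M},s\models\varphi\}$. *)

theory Defs
  imports Complex_Main "HOL-Library.Extended_Real" "HOL-Library.Countable"
begin

text \<open>
  The set of atomic propositions is a type \<open>'p\<close>, required to be of class \<^class>\<open>countable\<close> in the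
  theorem. As a type it is non-empty, which the Hennessy-Milner property needs: without atomic
  propositions the grammar below generates no formula at all.
\<close>

record ('s, 'p) wts =
  states :: "'s set"
  transitions :: "('s \<times> real \<times> 's) set"
  labelling :: "'s \<Rightarrow> 'p set"

definition is_wts :: "('s, 'p) wts \<Rightarrow> bool" where
  "is_wts M \<longleftrightarrow> states M \<noteq> {} \<and> transitions M \<subseteq> states M \<times> {0..} \<times> states M"

definition image_finite :: "('s, 'p) wts \<Rightarrow> bool" where
  "image_finite M \<longleftrightarrow> (\<forall>s\<in>states M. finite {t \<in> states M. \<exists>r. (s, r, t) \<in> transitions M})"

definition theta :: "('s, 'p) wts \<Rightarrow> 's \<Rightarrow> 's set \<Rightarrow> real set" where
  "theta M s T = {r. \<exists>t\<in>T. (s, r, t) \<in> transitions M}"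

text \<open>
  On the empty set, the values are opposite to the usual lattice conventions
  (in \<^typ>\<open>ereal\<close>, \<open>Inf {} = \<infinity>\<close> and \<open>Sup {} = - \<infinity>\<close>), hence the explicit case distinctions.
\<close>

definition theta_minus :: "('s, 'p) wts \<Rightarrow> 's \<Rightarrow> 's set \<Rightarrow> ereal" where
  "theta_minus M s T = (if theta M s T = {} then - \<infinity> else Inf (ereal ` theta M s T))"

definition theta_plus :: "('s, 'p) wts \<Rightarrow> 's \<Rightarrow> 's set \<Rightarrow> ereal" where
  "theta_plus M s T = (if theta M s T = {} then \<infinity> else Sup (ereal ` theta M s T))"

definition gen_weighted_bisimulation :: "('s, 'p) wts \<Rightarrow> 's rel \<Rightarrow> bool" where
  "gen_weighted_bisimulation M R \<longleftrightarrow>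
     equiv (states M) R \<and>
     (\<forall>(s, t) \<in> R. labelling M s = labelling M t \<and>
        (\<forall>T \<in> states M // R.
           theta_minus M s T = theta_minus M t T \<and> theta_plus M s T = theta_plus M t T))"

definition bisimilar :: "('s, 'p) wts \<Rightarrow> 's \<Rightarrow> 's \<Rightarrow> bool" where
  "bisimilar M s t \<longleftrightarrow> (\<exists>R. gen_weighted_bisimulation M R \<and> (s, t) \<in> R)"

typedef nonneg_rat = "{q :: rat. 0 \<le> q}"
  by auto

datatype 'p formula =
    Atom 'p
  | Neg "'p formula"
  | Conj "'p formula" "'p formula"
  | Mod_L nonneg_rat "'p formula"
  | Mod_M nonneg_rat "'p formula"

primrec sat :: "('s, 'p) wts \<Rightarrow> 'p formula \<Rightarrow> 's \<Rightarrow> bool" where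
  "sat M (Atom p) s \<longleftrightarrow> p \<in> labelling M s"
| "sat M (Neg \<phi>) s \<longleftrightarrow> \<not> sat M \<phi> s"
| "sat M (Conj \<phi> \<psi>) s \<longleftrightarrow> sat M \<phi> s \<and> sat M \<psi> s"
| "sat M (Mod_L r \<phi>) s \<longleftrightarrow>
     theta_minus M s {u \<in> states M. sat M \<phi> u} \<ge> ereal (of_rat (Rep_nonneg_rat r))"
| "sat M (Mod_M r \<phi>) s \<longleftrightarrow>
     theta_plus M s {u \<in> states M. sat M \<phi> u} \<le> ereal (of_rat (Rep_nonneg_rat r))"

end

theory Submission
  imports Defs
begin

text \<open>
  Soundness: satisfaction sets are unions of bisimulation classes, and bounds over such a union are
  determined by the bounds over the single classes. Weights being non-negative, \<open>\<theta>\<^sup>-\<close> detects whether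
  a class is reachable at all, which \<open>\<theta>\<^sup>+\<close> alone does not, as \<open>\<infinity>\<close> is also the supremum of an
  unbounded set of weights. Completeness: logical equivalence is itself a bisimulation, because on
  the finitely many successors of two states each of its classes is cut out by a single formula, and
  the modalities with rational bounds determine both bounds over that formula.
\<close>

section \<open>Signs of the bounds and reachability\<close>

lemma theta_nonneg:
  assumes "is_wts M" "r \<in> theta M s T"
  shows "0 \<le> r"
  using assms unfolding is_wts_def theta_def by fastforce

lemma theta_mono: "T \<subseteq> U \<Longrightarrow> theta M s T \<subseteq> theta M s U"
  unfolding theta_def by blast

lemma theta_minus_nonneg:
  assumes "is_wts M" "theta M s T \<noteq> {}"
  shows "0 \<le> theta_minus M s T"
  using assms theta_nonneg[OF assms(1)] by (auto simp: theta_minus_def intro!: Inf_greatest)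

lemma theta_plus_nonneg:
  assumes "is_wts M"
  shows "0 \<le> theta_plus M s T"
proof (cases "theta M s T = {}")
  case False
  then obtain r where r: "r \<in> theta M s T" by blast
  then have "ereal r \<le> theta_plus M s T"
    by (auto simp: theta_plus_def intro: Sup_upper)
  moreover have "0 \<le> ereal r"
    using theta_nonneg[OF assms r] by simp
  ultimately show ?thesis by order
qed (simp add: theta_plus_def)

lemma theta_empty_iff:
  assumes "is_wts M" "theta_minus M s T = theta_minus M t T"
  shows "theta M s T = {} \<longleftrightarrow> theta M t T = {}"
proof -
  \<comment> \<open>The default value \<open>- \<infinity>\<close> cannot be confused with an
    infimum of weights, which is at least 0.\<close>
  have "theta M u T = {} \<longleftrightarrow> theta_minus M u T = - \<infinity>" for u
    using theta_minus_nonneg[OF assms(1), of u T] by (auto simp: theta_minus_def)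
  then show ?thesis using assms(2) by metis
qed

section \<open>Soundness: bounds over unions of classes\<close>

lemma bisimulation_sym:
  assumes "gen_weighted_bisimulation M R" "(s, t) \<in> R"
  shows "(t, s) \<in> R"
  using assms unfolding gen_weighted_bisimulation_def equiv_def by (auto dest: symD)

text \<open>A transition from \<open>s\<close> into \<open>X\<close> ends in a single class
  \<open>T\<close>, which lies inside \<open>X\<close> because \<open>X\<close> is closed under
  \<open>R\<close>. The equal lower bounds on \<open>T\<close> force \<open>t\<close> to have a
  transition into \<open>T\<close> as well.\<close>

lemma bisimulation_class:
  assumes M: "is_wts M" and R: "gen_weighted_bisimulation M R" and st: "(s, t) \<in> R"
    and X: "X \<subseteq> states M" "R `` X \<subseteq> X"
    and r: "r \<in> theta M s X"
  obtains T where "T \<subseteq> X" "r \<in> theta M s T" "theta M s T \<noteq> {}" "theta M t T \<noteq> {}"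
    "theta_minus M s T = theta_minus M t T" "theta_plus M s T = theta_plus M t T"
proof -
  obtain u where u: "u \<in> X" "(s, r, u) \<in> transitions M"
    using r unfolding theta_def by blast
  define T where "T = R `` {u}"
  have E: "equiv (states M) R"
    using R unfolding gen_weighted_bisimulation_def by blast
  have "u \<in> states M" using u X by blast
  then have T: "T \<in> states M // R" "u \<in> T"
    unfolding T_def by (fact quotientI, fact equiv_class_self[OF E])
  have eq: "theta_minus M s T = theta_minus M t T" "theta_plus M s T = theta_plus M t T"
    using R st T(1) unfolding gen_weighted_bisimulation_def by blast+
  have "r \<in> theta M s T" using u T unfolding theta_def by blast
  moreover have "T \<subseteq> X" using X(2) u unfolding T_def by blast
  moreover have "theta M t T \<noteq> {}"
    using theta_empty_iff[OF M eq(1)] \<open>r \<in> theta M s T\<close> by blast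
  ultimately show ?thesis using that eq by blast
qed

text \<open>Each weight \<open>r\<close> from \<open>s\<close> into \<open>X\<close> goes into some
  class \<open>T\<close> inside \<open>X\<close>. Enlarging \<open>T\<close> to \<open>X\<close>
  only lowers the infimum for \<open>t\<close>, and on \<open>T\<close> the infimum for
  \<open>t\<close> is that for \<open>s\<close>, hence at most \<open>r\<close>.\<close>

lemma theta_minus_saturated_le:
  assumes "is_wts M" "gen_weighted_bisimulation M R" "(s, t) \<in> R"
    and "X \<subseteq> states M" "R `` X \<subseteq> X"
    and "theta M s X \<noteq> {}"
  shows "theta_minus M t X \<le> theta_minus M s X"
proof -
  have "theta_minus M t X \<le> ereal r" if r: "r \<in> theta M s X" for r
  proof -
    obtain T where T: "T \<subseteq> X" "r \<in> theta M s T" "theta M s T \<noteq> {}" "theta M t T \<noteq> {}"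
      "theta_minus M s T = theta_minus M t T"
      using bisimulation_class[OF assms(1-5) r] by metis
    have "theta M t X \<noteq> {}" using T theta_mono[OF T(1)] by blast
    then have "theta_minus M t X \<le> theta_minus M t T"
      using T(4) theta_mono[OF T(1), of M t]
      by (auto simp: theta_minus_def intro!: Inf_superset_mono)
    also have "\<dots> \<le> ereal r"
      using T(2,3) T(5)[symmetric] by (simp add: theta_minus_def Inf_lower)
    finally show ?thesis .
  qed
  then show ?thesis
    using assms(6) by (auto simp: theta_minus_def[of M s] intro: Inf_greatest)
qed

lemma theta_plus_saturated_ge:
  assumes "is_wts M" "gen_weighted_bisimulation M R" "(s, t) \<in> R"
    and "X \<subseteq> states M" "R `` X \<subseteq> X"
    and "theta M s X \<noteq> {}"
  shows "theta_plus M s X \<le> theta_plus M t X"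
proof -
  have "ereal r \<le> theta_plus M t X" if r: "r \<in> theta M s X" for r
  proof -
    obtain T where T: "T \<subseteq> X" "r \<in> theta M s T" "theta M s T \<noteq> {}" "theta M t T \<noteq> {}"
      "theta_plus M s T = theta_plus M t T"
      using bisimulation_class[OF assms(1-5) r] by metis
    have "ereal r \<le> theta_plus M t T"
      using T(2,3) T(5)[symmetric] by (simp add: theta_plus_def Sup_upper)
    \<comment> \<open>Since \<open>t\<close> reaches \<open>T\<close>, both sides are genuine
      suprema; the default \<open>\<infinity>\<close> on \<open>T\<close> would break
      monotonicity.\<close>
    also have "\<dots> \<le> theta_plus M t X"
      using T(4) theta_mono[OF T(1), of M t]
      by (auto simp: theta_plus_def intro!: Sup_subset_mono)
    finally show ?thesis .
  qed
  then show ?thesis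
    using assms(6) by (auto simp: theta_plus_def[of M s] intro: Sup_least)
qed

lemma theta_bounds_saturated:
  assumes "is_wts M" "gen_weighted_bisimulation M R" "(s, t) \<in> R"
    and "X \<subseteq> states M" "R `` X \<subseteq> X"
  shows "theta_minus M s X = theta_minus M t X" "theta_plus M s X = theta_plus M t X"
proof -
  have ts: "(t, s) \<in> R" using bisimulation_sym assms by metis
  \<comment> \<open>Reachability of \<open>X\<close> transfers along \<open>R\<close> in both
    directions, so \<open>s\<close> and \<open>t\<close> either both take the default values or both
    fall under the two inequalities.\<close>
  have ne: "theta M b X \<noteq> {}" if ab: "(a, b) \<in> R" and a: "theta M a X \<noteq> {}" for a b
  proof -
    obtain r where "r \<in> theta M a X" using a by blast
    from bisimulation_class[OF assms(1,2) ab assms(4,5) this] show ?thesis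
      by (metis subset_empty theta_mono)
  qed
  have "theta_minus M s X = theta_minus M t X \<and> theta_plus M s X = theta_plus M t X"
  proof (cases "theta M s X = {}")
    case True
    then have "theta M t X = {}" using ne[OF ts] by blast
    then show ?thesis using True by (simp add: theta_minus_def theta_plus_def)
  next
    case False
    then have F: "theta M t X \<noteq> {}" using ne assms(3) by blast
    show ?thesis
      using theta_minus_saturated_le[OF assms False] theta_plus_saturated_ge[OF assms False]
        theta_minus_saturated_le[OF assms(1,2) ts assms(4,5) F]
        theta_plus_saturated_ge[OF assms(1,2) ts assms(4,5) F]
      by (simp add: order_antisym)
  qed
  then show "theta_minus M s X = theta_minus M t X" "theta_plus M s X = theta_plus M t X"
    by auto
qed

lemma bisimulation_sat:
  assumes "is_wts M" "gen_weighted_bisimulation M R" "(s, t) \<in> R"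
  shows "sat M \<phi> s \<longleftrightarrow> sat M \<phi> t"
proof -
  have field: "R \<subseteq> states M \<times> states M"
    using assms(2) unfolding gen_weighted_bisimulation_def equiv_def refl_on_def by blast
  \<comment> \<open>The premise, later supplied by the induction hypothesis, says that the
    satisfaction set of \<open>\<phi>\<close> is closed under \<open>R\<close>.\<close>
  have bounds: "theta_minus M s {u \<in> states M. sat M \<phi> u} = theta_minus M t {u \<in> states M. sat M \<phi> u}
      \<and> theta_plus M s {u \<in> states M. sat M \<phi> u} = theta_plus M t {u \<in> states M. sat M \<phi> u}"
    if "\<And>u v. (u, v) \<in> R \<Longrightarrow> sat M \<phi> u \<longleftrightarrow> sat M \<phi> v" "(s, t) \<in> R" for \<phi> s t
    using theta_bounds_saturated[OF assms(1,2) that(2), of "{u \<in> states M. sat M \<phi> u}"] that(1) field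
    by blast
  show ?thesis using assms(3)
  proof (induction \<phi> arbitrary: s t)
    case (Atom p)
    then show ?case using assms(2) unfolding gen_weighted_bisimulation_def by auto
  next
    case (Mod_L r \<phi>)
    then show ?case using bounds[OF Mod_L.IH Mod_L.prems] by simp
  next
    case (Mod_M r \<phi>)
    then show ?case using bounds[OF Mod_M.IH Mod_M.prems] by simp
  qed auto
qed

section \<open>Completeness: recovering the bounds from rational modalities\<close>

lemma nonneg_rat_between:
  fixes a b :: ereal
  assumes "0 \<le> a" "a < b"
  obtains q where "a < ereal (of_rat (Rep_nonneg_rat q))" "ereal (of_rat (Rep_nonneg_rat q)) < b"
proof -
  obtain x where x: "a < ereal (of_rat x)" "ereal (of_rat x) < b"
    using ereal_dense3[OF assms(2)] by blast
  have "0 < ereal (of_rat x)" using assms(1) x(1) by order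
  then have "Rep_nonneg_rat (Abs_nonneg_rat x) = x"
    by (intro Abs_nonneg_rat_inverse) (simp add: less_imp_le)
  then show ?thesis using x that by metis
qed

lemma theta_minus_le_of_Mod_L:
  assumes M: "is_wts M"
    and sat: "\<And>q. sat M (Mod_L q \<phi>) t \<Longrightarrow> sat M (Mod_L q \<phi>) s"
  shows "theta_minus M t {u \<in> states M. sat M \<phi> u} \<le> theta_minus M s {u \<in> states M. sat M \<phi> u}"
    (is "?b \<le> ?a")
proof (cases "theta M t {u \<in> states M. sat M \<phi> u} = {}")
  case True
  then show ?thesis by (simp add: theta_minus_def)
next
  case False
  then have b: "0 \<le> ?b" using theta_minus_nonneg[OF M] by blast
  \<comment> \<open>Index 0 expresses reachability: \<open>t\<close> satisfies this formula, hence
    so does \<open>s\<close>, which excludes the default \<open>- \<infinity>\<close> for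
    \<open>?a\<close>. A rational above \<open>?a\<close> is then non-negative.\<close>
  have zero: "Rep_nonneg_rat (Abs_nonneg_rat 0) = 0"
    by (simp add: Abs_nonneg_rat_inverse)
  have a: "0 \<le> ?a" using sat[of "Abs_nonneg_rat 0"] b zero by (simp add: zero_ereal_def)
  show ?thesis
  proof (rule ccontr)
    assume "\<not> ?b \<le> ?a"
    \<comment> \<open>A rational \<open>q\<close> strictly in between makes
      \<open>Mod_L q \<phi>\<close> true at \<open>t\<close> and false at \<open>s\<close>.\<close>
    then have "?a < ?b" by simp
    from nonneg_rat_between[OF a this] obtain q
      where "?a < ereal (of_rat (Rep_nonneg_rat q))" "ereal (of_rat (Rep_nonneg_rat q)) < ?b" .
    then show False using sat[of q] by (simp add: less_imp_le)
  qed
qed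

text \<open>A rational strictly in between would index a formula true at \<open>t\<close> and false
  at \<open>s\<close>. It is an admissible index since \<open>theta_plus\<close> is never negative,
  its default being \<open>\<infinity>\<close>.\<close>

lemma theta_plus_le_of_Mod_M:
  assumes M: "is_wts M"
    and sat: "\<And>q. sat M (Mod_M q \<phi>) t \<Longrightarrow> sat M (Mod_M q \<phi>) s"
  shows "theta_plus M s {u \<in> states M. sat M \<phi> u} \<le> theta_plus M t {u \<in> states M. sat M \<phi> u}"
    (is "?a \<le> ?b")
proof (rule ccontr)
  assume "\<not> ?a \<le> ?b"
  then have "?b < ?a" by simp
  from nonneg_rat_between[OF theta_plus_nonneg[OF M] this] obtain q
    where "?b < ereal (of_rat (Rep_nonneg_rat q))" "ereal (of_rat (Rep_nonneg_rat q)) < ?a" .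
  then show False using sat[of q] by (simp add: less_imp_le)
qed

section \<open>Completeness: logical equivalence as a bisimulation\<close>

definition logical_equivalence :: "('s, 'p) wts \<Rightarrow> 's rel" where
  "logical_equivalence M =
     {(s, t). s \<in> states M \<and> t \<in> states M \<and> (\<forall>\<phi>. sat M \<phi> s \<longleftrightarrow> sat M \<phi> t)}"

lemma equiv_logical_equivalence: "equiv (states M) (logical_equivalence M)"
  by (rule equivI) (auto simp: logical_equivalence_def refl_on_def sym_def trans_def)

text \<open>Conjoin one formula for each element of \<open>V\<close>, negated where necessary so
  that it holds at \<open>u\<close>.\<close>

lemma separating_formula:
  fixes M :: "('s, 'p) wts"
  assumes "\<And>v. v \<in> V \<Longrightarrow> \<exists>\<phi>. sat M \<phi> u \<noteq> sat M \<phi> v" "finite V"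
  shows "\<exists>\<phi>. sat M \<phi> u \<and> (\<forall>v\<in>V. \<not> sat M \<phi> v)"
  using assms(2,1)
proof (induction V rule: finite_induct)
  case empty
  \<comment> \<open>The empty conjunction is replaced by a tautology over an arbitrary atom; one
    exists because types are inhabited.\<close>
  have "sat M (Neg (Conj (Atom p) (Neg (Atom p)))) u" for p :: 'p by simp
  then show ?case by blast
next
  case (insert v V)
  then obtain \<phi> where \<phi>: "sat M \<phi> u" "\<forall>v\<in>V. \<not> sat M \<phi> v" by auto
  obtain \<psi> where "sat M \<psi> u \<noteq> sat M \<psi> v" using insert.prems by blast
  then obtain \<chi> where "sat M \<chi> u" "\<not> sat M \<chi> v" by (metis sat.simps(2))
  then have "sat M (Conj \<phi> \<chi>) u \<and> (\<forall>w\<in>insert v V. \<not> sat M (Conj \<phi> \<chi>) w)"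
    using \<phi> by auto
  then show ?case by blast
qed

text \<open>Finitely many elements of \<open>U\<close> lie outside \<open>T\<close>, so one formula
  separates a representative of \<open>T\<close> from all of them. The other members of
  \<open>T\<close> satisfy whatever the representative satisfies.\<close>

lemma logical_class_formula:
  assumes "finite U" "U \<subseteq> states M" "T \<in> states M // logical_equivalence M"
  obtains \<phi> where "\<And>v. v \<in> U \<Longrightarrow> sat M \<phi> v \<longleftrightarrow> v \<in> T"
proof -
  obtain u where u: "u \<in> states M" "T = logical_equivalence M `` {u}"
    using assms(3) by (auto elim: quotientE)
  have "\<exists>\<phi>. sat M \<phi> u \<noteq> sat M \<phi> v" if "v \<in> U - T" for v
    using that u assms(2) unfolding logical_equivalence_def by auto
  then obtain \<phi> where "sat M \<phi> u" "\<forall>v\<in>U - T. \<not> sat M \<phi> v"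
    using separating_formula[of "U - T" M u] assms(1) by auto
  moreover have "sat M \<phi> v" if "sat M \<phi> u" "v \<in> T" for v
    using that u unfolding logical_equivalence_def by auto
  ultimately show ?thesis using that by blast
qed

lemma logical_equivalence_bisimulation:
  assumes M: "is_wts M" and fin: "image_finite M"
  shows "gen_weighted_bisimulation M (logical_equivalence M)"
  unfolding gen_weighted_bisimulation_def
proof (intro conjI equiv_logical_equivalence ballI, clarify)
  fix s t assume st: "(s, t) \<in> logical_equivalence M"
  then have in_M: "s \<in> states M" "t \<in> states M" and eq: "sat M \<phi> s \<longleftrightarrow> sat M \<phi> t" for \<phi>
    unfolding logical_equivalence_def by auto
  have "p \<in> labelling M s \<longleftrightarrow> p \<in> labelling M t" for p
    using eq[of "Atom p"] by simp
  then have "labelling M s = labelling M t" by blast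
  moreover have "theta_minus M s T = theta_minus M t T \<and> theta_plus M s T = theta_plus M t T"
    if T: "T \<in> states M // logical_equivalence M" for T
  proof -
    \<comment> \<open>Taking the successors of both states lets one formula describe
      \<open>T\<close> for \<open>s\<close> and \<open>t\<close> alike.\<close>
    define U where "U = {u \<in> states M. \<exists>r. (s, r, u) \<in> transitions M}
      \<union> {u \<in> states M. \<exists>r. (t, r, u) \<in> transitions M}"
    have "finite U" "U \<subseteq> states M"
      using fin in_M unfolding U_def image_finite_def by auto
    then obtain \<phi> where \<phi>: "\<And>v. v \<in> U \<Longrightarrow> sat M \<phi> v \<longleftrightarrow> v \<in> T"
      using logical_class_formula T by metis
    define X where "X = {u \<in> states M. sat M \<phi> u}"
    have U: "u \<in> U \<and> u \<in> states M" if "(a, r, u) \<in> transitions M" "a \<in> {s, t}" for a r u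
      using that M unfolding U_def is_wts_def by blast
    \<comment> \<open>\<open>T\<close> and \<open>X\<close> may differ, but only outside
      \<open>U\<close>, where no transition from \<open>s\<close> or \<open>t\<close> leads.\<close>
    have theta: "theta M a T = theta M a X" if "a \<in> {s, t}" for a
      using U[OF _ that] \<phi> unfolding theta_def X_def by blast
    have bounds: "theta_minus M a T = theta_minus M a X" "theta_plus M a T = theta_plus M a X"
      if "a \<in> {s, t}" for a
      using theta[OF that] by (simp_all add: theta_minus_def theta_plus_def)
    have "theta_minus M s X = theta_minus M t X"
      unfolding X_def by (intro order_antisym theta_minus_le_of_Mod_L[OF M]) (use eq in blast)+
    moreover have "theta_plus M s X = theta_plus M t X"
      unfolding X_def by (intro order_antisym theta_plus_le_of_Mod_M[OF M]) (use eq in blast)+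
    ultimately show ?thesis
      using bounds by simp
  qed
  ultimately show "labelling M s = labelling M t \<and>
      (\<forall>T\<in>states M // logical_equivalence M.
         theta_minus M s T = theta_minus M t T \<and> theta_plus M s T = theta_plus M t T)"
    by blast
qed

theorem theorem3p6:
  fixes M :: "('s, 'p :: countable) wts" and s t :: 's
  assumes "is_wts M" and "s \<in> states M" and "t \<in> states M"
  shows "(bisimilar M s t \<longrightarrow> (\<forall>\<phi>. sat M \<phi> s \<longleftrightarrow> sat M \<phi> t)) \<and>
         (image_finite M \<longrightarrow> (\<forall>\<phi>. sat M \<phi> s \<longleftrightarrow> sat M \<phi> t) \<longrightarrow> bisimilar M s t)"
proof (intro conjI impI)
  assume "bisimilar M s t"
  then show "\<forall>\<phi>. sat M \<phi> s \<longleftrightarrow> sat M \<phi> t"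
    using bisimulation_sat[OF assms(1)] unfolding bisimilar_def by blast
next
  assume "image_finite M" "\<forall>\<phi>. sat M \<phi> s \<longleftrightarrow> sat M \<phi> t"
  then show "bisimilar M s t"
    using logical_equivalence_bisimulation[OF assms(1)] assms(2,3)
    unfolding bisimilar_def logical_equivalence_def by blast
qed

end
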